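(* Let $K$ be an algebraically closed field of characteristic $0$, let $n\ge2$, and let $A_n:\mathbb{A}^2\to\mathbb{A}^2$ be the $n$th folding map over $K$ associated to the Lie algebra $\mathcal{A}_2$. Then $$\operatorname{Aut}(A_n)\cong\begin{cases}\mathcal{S}_3&\text{if } n\equiv1\pmod3,\\ \boldsymbol{\mu}_2&\text{if } n\not\equiv1\pmod3.\end{cases}$$ Explicitly, if $\zeta$ is a primitive cube root of unity, then the maps in $\operatorname{Aut}(A_n)$ are $$\operatorname{Aut}(A_n)=\begin{cases}\{z,\ \zeta z,\ \zeta^2z,\ \bar z,\ \zeta\bar z,\ \zeta^2\bar z\}&\text{if } n\equiv1\pmod3,\\ \{z,\ \bar z\}&\text{if } n\not\equiv1\pmod3.\end{cases}$$
   Context: Fix $i\in K$ with $i^2=-1$, and write $z=x+iy$, $\bar z=x-iy$ for the linear coordinates on $\mathbb{A}^2$. The folding map is $A_n(x,y)=(X_n,Y_n)$ with $X_n,Y_n\in\mathbb{Z}[x,y]$ given by $(X_0,Y_0)=(3,0)$, $(X_1,Y_1)=(x,y)$, $(X_2,Y_2)=(x^2-y^2-2x,\ 2xy+2y)$, and for $n\ge3$ $$X_n=x(X_{n-1}-X_{n-2})-y(Y_{n-1}+Y_{n-2})+X_{n-3},\qquad Y_n=x(Y_{n-1}-Y_{n-2})+y(X_{n-1}+X_{n-2})+Y_{n-3}.$$ Equivalently, writing $A_n(z,\bar z)=X_n+iY_n\in\mathbb{Z}[z,\bar z]$, one has $A_0=3$, $A_1=z$, $A_2=z^2-2\bar z$,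 $A_n=zA_{n-1}-\bar zA_{n-2}+A_{n-3}$, and in the coordinates $(z,\bar z)$ the folding map is $(z,\bar z)\mapsto(A_n(z,\bar z),A_n(\bar z,z))$. $\operatorname{Aut}(A_n)$ is the group of affine automorphisms $\varphi$ of $\mathbb{A}^2$ over $K$ (maps $\mathbf{v}\mapsto M\mathbf{v}+\mathbf{b}$ with $M\in\mathrm{GL}_2(K)$, $\mathbf{b}\in K^2$) satisfying $\varphi^{-1}\circ A_n\circ\varphi=A_n$. For a cube root of unity $\xi$, the symbol $\xi z$ denotes the linear automorphism of $\mathbb{A}^2$ given in the coordinates $(z,\bar z)$ by $(z,\bar z)\mapsto(\xi z,\xi^{-1}\bar z)$, and the symbol $\xi\bar z$ denotes $(z,\bar z)\mapsto(\xi\bar z,\xi^{-1}z)$. (When $K=\mathbb{C}$ and $x,y$ are real, these are the maps $z\mapsto\xi z$ and $z\mapsto\xi\bar z$ of $\mathbb{C}$, with $\bar z$ the complex conjugate.) $\mathcal{S}_3$ is the symmetric group on 3 letters, $\boldsymbol{\mu}_2$ the cyclic group of order 2. *)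

theory Defs
  imports
    "HOL-Analysis.Cartesian_Space"
    "HOL-Algebra.Sym_Groups"
    "HOL-Algebra.Elementary_Groups"
    "HOL-Computational_Algebra.Polynomial"
    "HOL-Number_Theory.Cong"
begin

(* The recursion has integer coefficients and is stated over an arbitrary commutative ring:
   at a point (x, y) of K x K it gives the value there of the pair (X_n, Y_n), and at the two
   variables of a polynomial ring over the integers it gives the polynomials themselves.
   These readings agree by folding_XY_hom. *)
fun folding_X :: "'a::comm_ring_1 \<Rightarrow> 'a \<Rightarrow> nat \<Rightarrow> 'a"
  and folding_Y :: "'a::comm_ring_1 \<Rightarrow> 'a \<Rightarrow> nat \<Rightarrow> 'a"
where
  "folding_X x y 0 = 3"
| "folding_X x y (Suc 0) = x"
| "folding_X x y (Suc (Suc 0)) = x^2 - y^2 - 2 * x"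
| "folding_X x y (Suc (Suc (Suc n))) =
     x * (folding_X x y (Suc (Suc n)) - folding_X x y (Suc n))
     - y * (folding_Y x y (Suc (Suc n)) + folding_Y x y (Suc n)) + folding_X x y n"
| "folding_Y x y 0 = 0"
| "folding_Y x y (Suc 0) = y"
| "folding_Y x y (Suc (Suc 0)) = 2 * x * y + 2 * y"
| "folding_Y x y (Suc (Suc (Suc n))) =
     x * (folding_Y x y (Suc (Suc n)) - folding_Y x y (Suc n))
     + y * (folding_X x y (Suc (Suc n)) + folding_X x y (Suc n)) + folding_Y x y n"

lemma folding_XY_hom:
  fixes h :: "'a::comm_ring_1 \<Rightarrow> 'b::comm_ring_1"
  assumes one: "h 1 = 1" and add: "\<And>a b. h (a + b) = h a + h b"
    and mult: "\<And>a b. h (a * b) = h a * h b"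
  shows "h (folding_X x y n) = folding_X (h x) (h y) n"
    and "h (folding_Y x y n) = folding_Y (h x) (h y) n"
proof -
  have zero: "h 0 = 0"
    using add[of 0 0] by simp
  have diff: "h (a - b) = h a - h b" for a b
    using add[of "a - b" b] by (simp add: algebra_simps)
  have two: "h 2 = 2"
    using add[of 1 1] one by simp
  have three: "h 3 = 3"
    using add[of 2 1] one two by simp
  show "h (folding_X x y n) = folding_X (h x) (h y) n"
    and "h (folding_Y x y n) = folding_Y (h x) (h y) n"
    by (induction x y n and x y n rule: folding_X_folding_Y.induct)
       (simp_all add: zero two three add mult diff power2_eq_square)
qed

(* The first component of the n-th folding map in the linear coordinates (z, w) = (x + i y, x - i y),
   where w stands for the conjugate of z; not used in the definitions below. *)
fun folding_A :: "'a::comm_ring_1 \<Rightarrow> 'a \<Rightarrow> nat \<Rightarrow> 'a" where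
  "folding_A z w 0 = 3"
| "folding_A z w (Suc 0) = z"
| "folding_A z w (Suc (Suc 0)) = z^2 - 2 * w"
| "folding_A z w (Suc (Suc (Suc n))) =
     z * folding_A z w (Suc (Suc n)) - w * folding_A z w (Suc n) + folding_A z w n"

lemma folding_A_eq:
  fixes i :: "'a::comm_ring_1"
  assumes "i^2 = -1"
  shows "folding_A (x + i * y) (x - i * y) n = folding_X x y n + i * folding_Y x y n"
proof -
  have ii: "i * i = -1" "\<And>a. i * (i * a) = - a"
    using assms by (simp_all add: power2_eq_square mult.assoc [symmetric])
  show ?thesis
    by (induction "x + i * y" "x - i * y" n rule: folding_A.induct)
       (simp_all add: power2_eq_square algebra_simps ii)
qed

definition folding_map :: "nat \<Rightarrow> 'a::comm_ring_1 ^ 2 \<Rightarrow> 'a ^ 2" where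
  "folding_map n v = vector [folding_X (v $ 1) (v $ 2) n, folding_Y (v $ 1) (v $ 2) n]"

definition affine_automorphism :: "('a::field ^ 2 \<Rightarrow> 'a ^ 2) \<Rightarrow> bool" where
  "affine_automorphism \<phi> \<longleftrightarrow>
     (\<exists>(M :: 'a ^ 2 ^ 2) b. invertible M \<and> \<phi> = (\<lambda>v. M *v v + b))"

definition folding_Aut :: "nat \<Rightarrow> ('a::field ^ 2 \<Rightarrow> 'a ^ 2) monoid" where
  "folding_Aut n =
     \<lparr>carrier = {\<phi>. affine_automorphism \<phi> \<and> inv' \<phi> \<circ> folding_map n \<circ> \<phi> = folding_map n},
      mult = (\<circ>), one = id\<rparr>"

definition z_coords :: "'a::comm_ring_1 \<Rightarrow> 'a ^ 2 \<Rightarrow> 'a ^ 2" where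
  "z_coords i v = vector [v $ 1 + i * v $ 2, v $ 1 - i * v $ 2]"

(* The maps (z, w) |-> (\<xi> z, \<xi>^{-1} w) and (z, w) |-> (\<xi> w, \<xi>^{-1} z), expressed in the
   coordinates (x, y). *)
definition z_map :: "'a::field \<Rightarrow> 'a \<Rightarrow> 'a ^ 2 \<Rightarrow> 'a ^ 2" where
  "z_map i \<xi> = inv' (z_coords i) \<circ> (\<lambda>u. vector [\<xi> * u $ 1, inverse \<xi> * u $ 2]) \<circ> z_coords i"

definition zbar_map :: "'a::field \<Rightarrow> 'a \<Rightarrow> 'a ^ 2 \<Rightarrow> 'a ^ 2" where
  "zbar_map i \<xi> = inv' (z_coords i) \<circ> (\<lambda>u. vector [\<xi> * u $ 2, inverse \<xi> * u $ 1]) \<circ> z_coords i"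

definition primitive_root_of_unity :: "nat \<Rightarrow> 'a::monoid_mult \<Rightarrow> bool" where
  "primitive_root_of_unity k \<xi> \<longleftrightarrow> 0 < k \<and> \<xi> ^ k = 1 \<and> (\<forall>j. 0 < j \<and> j < k \<longrightarrow> \<xi> ^ j \<noteq> 1)"

lemma bij_z_coords:
  fixes i :: "'a::field_char_0"
  assumes "i^2 = -1"
  shows "bij (z_coords i)"
proof (rule o_bij)
  have i0: "i \<noteq> 0" using assms by auto
  let ?g = "\<lambda>u :: 'a ^ 2. vector [(u $ 1 + u $ 2) / 2, (u $ 1 - u $ 2) / (2 * i)] :: 'a ^ 2"
  show "?g \<circ> z_coords i = id" "z_coords i \<circ> ?g = id"
    using i0 by (auto simp: fun_eq_iff vec_eq_iff forall_2 z_coords_def field_simps)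
qed

lemma affine_automorphism_bij:
  assumes "affine_automorphism \<phi>"
  shows "bij \<phi>" and "affine_automorphism (inv' \<phi>)"
proof -
  obtain M N :: "'a ^ 2 ^ 2" and b
    where MN: "M ** N = mat 1" "N ** M = mat 1" and \<phi>: "\<phi> = (\<lambda>v. M *v v + b)"
    using assms by (auto simp: affine_automorphism_def invertible_def)
  let ?g = "\<lambda>v. N *v v + - (N *v b)"
  have g: "?g \<circ> \<phi> = id" "\<phi> \<circ> ?g = id"
    by (auto simp: fun_eq_iff \<phi> matrix_vector_right_distrib matrix_vector_mul_assoc MN
        matrix_vector_mult_diff_distrib)
  show "bij \<phi>" using g by (rule o_bij)
  have "inv' \<phi> = ?g" using g by (simp add: inv_unique_comp)
  moreover have "invertible N" using MN by (auto simp: invertible_def)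
  ultimately show "affine_automorphism (inv' \<phi>)"
    unfolding affine_automorphism_def by blast
qed

lemma affine_automorphism_comp:
  assumes "affine_automorphism \<phi>" "affine_automorphism \<psi>"
  shows "affine_automorphism (\<phi> \<circ> \<psi>)"
proof -
  obtain M N :: "'a ^ 2 ^ 2" and b c
    where "invertible M" "invertible N" "\<phi> = (\<lambda>v. M *v v + b)" "\<psi> = (\<lambda>v. N *v v + c)"
    using assms by (auto simp: affine_automorphism_def)
  then have "invertible (M ** N)" "\<phi> \<circ> \<psi> = (\<lambda>v. (M ** N) *v v + (M *v c + b))"
    by (auto simp: invertible_mult fun_eq_iff matrix_vector_right_distrib matrix_vector_mul_assoc)
  then show ?thesis by (auto simp: affine_automorphism_def)
qed

lemma group_folding_Aut: "group (folding_Aut n :: ('a::field ^ 2 \<Rightarrow> 'a ^ 2) monoid)"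
proof -
  let ?F = "folding_map n :: 'a ^ 2 \<Rightarrow> 'a ^ 2"
  have comm: "inv' \<phi> \<circ> ?F \<circ> \<phi> = ?F \<longleftrightarrow> ?F \<circ> \<phi> = \<phi> \<circ> ?F" if "bij \<phi>" for \<phi>
  proof
    assume "inv' \<phi> \<circ> ?F \<circ> \<phi> = ?F"
    then have "\<phi> \<circ> (inv' \<phi> \<circ> ?F \<circ> \<phi>) = \<phi> \<circ> ?F" by simp
    then show "?F \<circ> \<phi> = \<phi> \<circ> ?F"
      using that by (simp add: fun_eq_iff bij_inv_eq_iff bij_is_surj surj_f_inv_f)
  next
    assume "?F \<circ> \<phi> = \<phi> \<circ> ?F"
    then show "inv' \<phi> \<circ> ?F \<circ> \<phi> = ?F"
      using that by (simp add: fun_eq_iff bij_is_inj)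
  qed
  have carrier: "\<phi> \<in> carrier (folding_Aut n) \<longleftrightarrow>
      affine_automorphism \<phi> \<and> ?F \<circ> \<phi> = \<phi> \<circ> ?F" for \<phi>
    using comm affine_automorphism_bij(1) by (auto simp: folding_Aut_def)
  have mult: "mult (folding_Aut n) = ((\<circ>) :: ('a ^ 2 \<Rightarrow> 'a ^ 2) \<Rightarrow> _)"
    and one: "one (folding_Aut n) = (id :: 'a ^ 2 \<Rightarrow> 'a ^ 2)"
    by (simp_all add: folding_Aut_def)
  have id: "affine_automorphism (id :: 'a ^ 2 \<Rightarrow> 'a ^ 2)"
    unfolding affine_automorphism_def
    by (rule exI[of _ "mat 1"], rule exI[of _ 0]) (auto simp: invertible_def fun_eq_iff)
  show ?thesis
  proof (rule groupI, unfold carrier mult one)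
    fix \<phi> \<psi> :: "'a ^ 2 \<Rightarrow> 'a ^ 2"
    assume "affine_automorphism \<phi> \<and> ?F \<circ> \<phi> = \<phi> \<circ> ?F"
      and "affine_automorphism \<psi> \<and> ?F \<circ> \<psi> = \<psi> \<circ> ?F"
    then show "affine_automorphism (\<phi> \<circ> \<psi>) \<and> ?F \<circ> (\<phi> \<circ> \<psi>) = \<phi> \<circ> \<psi> \<circ> ?F"
      by (auto simp: affine_automorphism_comp fun_eq_iff)
  next
    fix \<phi> :: "'a ^ 2 \<Rightarrow> 'a ^ 2"
    assume \<phi>: "affine_automorphism \<phi> \<and> ?F \<circ> \<phi> = \<phi> \<circ> ?F"
    then have b: "bij \<phi>" using affine_automorphism_bij by blast
    have "?F (inv' \<phi> v) = inv' \<phi> (?F v)" for v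
    proof -
      have "\<phi> (?F (inv' \<phi> v)) = ?F v"
        using \<phi> b by (metis bij_inv_eq_iff comp_apply)
      then show ?thesis using b by (metis bij_inv_eq_iff)
    qed
    then show "\<exists>\<psi>\<in>carrier (folding_Aut n). \<psi> \<circ> \<phi> = id"
      using \<phi> b affine_automorphism_bij(2)
      by (intro bexI[of _ "inv' \<phi>"]) (auto simp: carrier fun_eq_iff bij_is_inj)
  qed (auto simp: id)
qed

end

(* In the coordinates (z, w), restrict the commutation relation for an affine map with first
   component alpha z + beta w + gamma to the lines t |-> (t a, t b), and compare the coefficients
   of t^n and t^(n-1). The top one gives (alpha a + beta b)^n = alpha a^n + beta b^n and hence
   alpha beta = 0; the next one forces gamma = 0 and makes each of the two multipliers the square
   of the other. So the multipliers are xi and xi^2 with xi^3 = 1 and xi^n = xi, and all of these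
   occur, since A_n(xi z, xi^2 w) = xi^n A_n(z, w). For n = 1 (mod 3) the resulting six maps act
   faithfully on the three points (xi, xi^2) with xi^3 = 1. *)

theory Submission
  imports Defs "HOL-Analysis.Determinants"
begin

section \<open>Values and leading coefficients of A_n along lines\<close>

lemma poly_folding_A: "poly (folding_A p q n) t = folding_A (poly p t) (poly q t) n"
  by (induction p q n rule: folding_A.induct) simp_all

text \<open>Give z weight 1 and w weight 2. By the recursion every monomial of A_n has weight
  congruent to n modulo 3; the summand A_(n-3) fits because \<open>\<xi>^3 = 1\<close>.\<close>

lemma folding_A_scale:
  fixes \<xi> :: "'a::comm_ring_1"
  assumes "\<xi>^3 = 1"
  shows "folding_A (\<xi> * z) (\<xi>^2 * w) n = \<xi>^n * folding_A z w n"
proof (induction z w n rule: folding_A.induct)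
  case (4 z w n)
  have n3: "\<xi> ^ Suc (Suc (Suc n)) = \<xi> ^ n"
    using assms by (simp add: power3_eq_cube mult.assoc [symmetric])
  have "folding_A (\<xi> * z) (\<xi>^2 * w) (Suc (Suc (Suc n))) =
      \<xi> ^ Suc (Suc (Suc n)) * (z * folding_A z w (Suc (Suc n)) - w * folding_A z w (Suc n))
      + \<xi> ^ n * folding_A z w n"
    by (simp only: folding_A.simps 4) (simp add: algebra_simps power2_eq_square del: folding_A.simps)
  then show ?case
    by (simp only: n3 folding_A.simps distrib_left)
qed (simp_all add: algebra_simps power2_eq_square)

text \<open>The arguments \<open>[:c, a:]\<close> and \<open>[:d, b:]\<close> parametrise the line
  (c + a t, d + b t). On it A_n becomes a polynomial in t, of which only the coefficients at t^n and
  t^(n-1) will matter.\<close>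

lemma coeff_folding_A_eq_0: "n < k \<Longrightarrow> coeff (folding_A [:c, a:] [:d, b:] n) k = 0"
proof (induction "[:c, a:]" "[:d, b:]" n arbitrary: k rule: folding_A.induct)
  case (4 n)
  then obtain j where "k = Suc j" by (cases k) auto
  with 4 show ?case by simp
qed (auto simp: coeff_pCons power2_eq_square numeral_poly split: nat.splits)

text \<open>Only the summand z A_(n-1) of the recursion reaches degree n. The index is
  \<open>Suc n\<close> because A_0 = 3 breaks the pattern.\<close>

lemma coeff_folding_A_top: "coeff (folding_A [:c, a:] [:d, b:] (Suc n)) (Suc n) = a ^ Suc n"
proof (induction n rule: induct_nat_012)
  case 1
  show ?case by (simp add: power2_eq_square numeral_poly)
next
  case (ge2 n)
  then show ?case by (simp add: coeff_folding_A_eq_0)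
qed simp

text \<open>This reflects A_n = z^n - n z^(n-2) w + (terms of degree at most n - 2), with
  \<open>n + 2\<close> in the role of the index: z^n contributes through the constant term c, the
  next monomial through the slope b.\<close>

lemma coeff_folding_A_subtop:
  "coeff (folding_A [:c, a:] [:d, b:] (Suc (Suc n))) (Suc n) =
     of_nat (n + 2) * (a ^ Suc n * c - a ^ n * b)"
proof (induction n)
  case 0
  show ?case by (simp add: power2_eq_square numeral_poly algebra_simps)
next
  case (Suc n)
  have "coeff (folding_A [:c, a:] [:d, b:] (Suc (Suc (Suc n)))) (Suc (Suc n)) =
      c * a ^ Suc (Suc n) + a * (of_nat (n + 2) * (a ^ Suc n * c - a ^ n * b)) - b * a ^ Suc n"
    using Suc coeff_folding_A_top[of c a d b "Suc n"] coeff_folding_A_top[of c a d b n]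
    by (simp add: coeff_folding_A_eq_0 del: folding_A.simps(1-3))
  also have "\<dots> = of_nat (Suc n + 2) * (a ^ Suc (Suc n) * c - a ^ Suc n * b)"
    by (simp add: algebra_simps)
  finally show ?case .
qed

text \<open>The hypothesis is one component of the commutation relation. Restricted to the line (t
  a, t b) it becomes an identity of polynomials in t, and the conclusions are its coefficients at
  t^(m+2) and t^(m+1), the latter divided by m + 2.\<close>

lemma folding_A_affine_coeffs:
  fixes \<alpha> \<beta> \<gamma> \<alpha>' \<beta>' \<gamma>' :: "'a::field_char_0"
  assumes eq: "\<And>z w. folding_A (\<alpha> * z + \<beta> * w + \<gamma>) (\<alpha>' * z + \<beta>' * w + \<gamma>') (Suc (Suc m)) =
      \<alpha> * folding_A z w (Suc (Suc m)) + \<beta> * folding_A w z (Suc (Suc m)) + \<gamma>"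
  shows "(\<alpha> * a + \<beta> * b) ^ Suc (Suc m) = \<alpha> * a ^ Suc (Suc m) + \<beta> * b ^ Suc (Suc m)"
    and "(\<alpha> * a + \<beta> * b) ^ Suc m * \<gamma> - (\<alpha> * a + \<beta> * b) ^ m * (\<alpha>' * a + \<beta>' * b) =
      - (\<alpha> * a ^ m * b + \<beta> * b ^ m * a)"
proof -
  let ?n = "Suc (Suc m)"
  have "poly (folding_A [:\<gamma>, \<alpha> * a + \<beta> * b:] [:\<gamma>', \<alpha>' * a + \<beta>' * b:] ?n) t =
      poly (smult \<alpha> (folding_A [:0, a:] [:0, b:] ?n) + smult \<beta> (folding_A [:0, b:] [:0, a:] ?n)
        + [:\<gamma>:]) t" for t
    using eq[of "t * a" "t * b"]
    by (simp add: poly_folding_A algebra_simps del: folding_A.simps)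
  \<comment> \<open>A field of characteristic 0 is infinite, so polynomials with equal values
    everywhere are equal.\<close>
  then have "folding_A [:\<gamma>, \<alpha> * a + \<beta> * b:] [:\<gamma>', \<alpha>' * a + \<beta>' * b:] ?n =
      smult \<alpha> (folding_A [:0, a:] [:0, b:] ?n) + smult \<beta> (folding_A [:0, b:] [:0, a:] ?n) + [:\<gamma>:]"
    (is "?l = ?r")
    by (simp flip: poly_eq_poly_eq_iff add: fun_eq_iff del: folding_A.simps)
  then have eqc: "coeff ?l k = coeff ?r k" for k
    by simp
  show "(\<alpha> * a + \<beta> * b) ^ ?n = \<alpha> * a ^ ?n + \<beta> * b ^ ?n"
    using eqc[of ?n]
    by (simp only: coeff_folding_A_top coeff_add coeff_smult coeff_pCons_Suc coeff_0 add_0_right)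
  \<comment> \<open>The exponent m + 1 is positive, so the constant polynomial
    \<open>[:\<gamma>:]\<close> on the right contributes 0.\<close>
  have "of_nat (m + 2) * ((\<alpha> * a + \<beta> * b) ^ Suc m * \<gamma> - (\<alpha> * a + \<beta> * b) ^ m * (\<alpha>' * a + \<beta>' * b)) =
      \<alpha> * (of_nat (m + 2) * (a ^ Suc m * 0 - a ^ m * b)) + \<beta> * (of_nat (m + 2) * (b ^ Suc m * 0 - b ^ m * a)) + 0"
    using eqc[of "Suc m"]
    by (simp only: coeff_folding_A_subtop coeff_add coeff_smult coeff_pCons_Suc coeff_0)
  also have "\<dots> = of_nat (m + 2) * (- (\<alpha> * a ^ m * b + \<beta> * b ^ m * a))"
    by (simp add: algebra_simps)
  finally have "of_nat (m + 2) * ((\<alpha> * a + \<beta> * b) ^ Suc m * \<gamma> - (\<alpha> * a + \<beta> * b) ^ m * (\<alpha>' * a + \<beta>' * b)) =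
      of_nat (m + 2) * (- (\<alpha> * a ^ m * b + \<beta> * b ^ m * a))" .
  moreover have "(of_nat (m + 2) :: 'a) \<noteq> 0"
    by (simp only: of_nat_eq_0_iff)
  ultimately show "(\<alpha> * a + \<beta> * b) ^ Suc m * \<gamma> - (\<alpha> * a + \<beta> * b) ^ m * (\<alpha>' * a + \<beta>' * b) =
      - (\<alpha> * a ^ m * b + \<beta> * b ^ m * a)"
    by (simp only: mult_cancel_left) blast
qed

text \<open>As polynomials in b, the left side has linear coefficient (m + 2) \<alpha>^(m+1)
  \<beta>, while the right side has none since the exponent is at least 2. The linear coefficient is
  read off as the derivative at 0.\<close>

lemma power_additive_imp_zero:
  fixes \<alpha> \<beta> :: "'a::field_char_0"
  assumes "\<And>b. (\<alpha> + \<beta> * b) ^ Suc (Suc m) = \<alpha> + \<beta> * b ^ Suc (Suc m)"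
  shows "\<alpha> = 0 \<or> \<beta> = 0"
proof -
  have "poly ([:\<alpha>, \<beta>:] ^ Suc (Suc m)) b = poly (monom \<beta> (Suc (Suc m)) + [:\<alpha>:]) b" for b
    using assms[of b] by (simp add: poly_monom algebra_simps)
  then have "[:\<alpha>, \<beta>:] ^ Suc (Suc m) = monom \<beta> (Suc (Suc m)) + [:\<alpha>:]"
    by (simp flip: poly_eq_poly_eq_iff add: fun_eq_iff)
  then have "poly (pderiv ([:\<alpha>, \<beta>:] ^ Suc (Suc m))) 0 = poly (pderiv (monom \<beta> (Suc (Suc m)) + [:\<alpha>:])) 0"
    by simp
  then have "of_nat (Suc (Suc m)) * (\<alpha> ^ Suc m * \<beta>) = 0"
    by (auto simp: pderiv_power_Suc pderiv_monom pderiv_add pderiv_pCons poly_monom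
        simp del: power_Suc of_nat_Suc)
  then show ?thesis
    by (auto simp del: of_nat_Suc)
qed

text \<open>Everything that one component of the commutation relation yields when its first
  coefficient is nonzero, obtained from the directions (1, b), (1, 0) and (1, 1). The premise
  \<open>\<alpha>' = 0\<close> of the last two conclusions will be supplied by the other
  component.\<close>

lemma folding_A_diagonal_commute:
  fixes \<alpha> \<beta> \<gamma> \<alpha>' \<beta>' \<gamma>' :: "'a::field_char_0"
  assumes n: "n \<ge> 2" and \<alpha>: "\<alpha> \<noteq> 0"
    and eq: "\<And>z w. folding_A (\<alpha> * z + \<beta> * w + \<gamma>) (\<alpha>' * z + \<beta>' * w + \<gamma>') n =
      \<alpha> * folding_A z w n + \<beta> * folding_A w z n + \<gamma>"
  shows "\<beta> = 0" and "\<alpha> ^ n = \<alpha>" and "\<alpha>' = 0 \<Longrightarrow> \<gamma> = 0" and "\<alpha>' = 0 \<Longrightarrow> \<beta>' = \<alpha>^2"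
proof -
  obtain m where m: "n = Suc (Suc m)"
    using n by (metis add_2_eq_Suc le_Suc_ex)
  note coeffs = folding_A_affine_coeffs[OF eq[unfolded m]]
  have "(\<alpha> + \<beta> * b) ^ Suc (Suc m) = \<alpha> + \<beta> * b ^ Suc (Suc m)" for b
    using coeffs(1)[of 1 b] by simp
  then show \<beta>: "\<beta> = 0"
    using power_additive_imp_zero \<alpha> by metis
  show pow: "\<alpha> ^ n = \<alpha>"
    using coeffs(1)[of 1 0] by (simp add: m \<beta>)
  assume \<alpha>': "\<alpha>' = 0"
  show \<gamma>: "\<gamma> = 0"
    using coeffs(2)[of 1 0] \<alpha> by (simp add: \<beta> \<alpha>')
  have "\<alpha> ^ m * \<beta>' = \<alpha>"
    using coeffs(2)[of 1 1] by (simp add: \<beta> \<alpha>' \<gamma>)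
  \<comment> \<open>Multiplication by \<open>\<alpha>^2\<close> turns \<open>\<alpha> ^ m\<close>
    into \<open>\<alpha> ^ n\<close>, which equals \<open>\<alpha>\<close> and then cancels.\<close>
  then have "\<alpha> * \<alpha>^2 = \<alpha> ^ n * \<beta>'"
    by (simp add: m power2_eq_square mult.assoc)
  then show "\<beta>' = \<alpha>^2"
    using \<alpha> by (simp add: pow)
qed

text \<open>A nonzero entry of the coefficient matrix kills the other entry of its row, and nonzero
  columns then force a diagonal or antidiagonal shape. In either shape the two surviving entries are
  squares of each other, so they are cube roots of unity.\<close>

lemma folding_A_affine_commute:
  fixes \<alpha> \<beta> \<gamma> \<alpha>' \<beta>' \<gamma>' :: "'a::field_char_0"
  assumes n: "n \<ge> 2"
    and eq1: "\<And>z w. folding_A (\<alpha> * z + \<beta> * w + \<gamma>) (\<alpha>' * z + \<beta>' * w + \<gamma>') n =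
      \<alpha> * folding_A z w n + \<beta> * folding_A w z n + \<gamma>"
    and eq2: "\<And>z w. folding_A (\<alpha>' * z + \<beta>' * w + \<gamma>') (\<alpha> * z + \<beta> * w + \<gamma>) n =
      \<alpha>' * folding_A z w n + \<beta>' * folding_A w z n + \<gamma>'"
    and nz: "\<alpha> \<noteq> 0 \<or> \<alpha>' \<noteq> 0" "\<beta> \<noteq> 0 \<or> \<beta>' \<noteq> 0"
  obtains \<xi> where "\<xi>^3 = 1" "\<xi>^n = \<xi>" "\<gamma> = 0" "\<gamma>' = 0"
    "\<alpha> = \<xi> \<and> \<beta> = 0 \<and> \<alpha>' = 0 \<and> \<beta>' = \<xi>^2 \<or> \<alpha> = 0 \<and> \<beta> = \<xi> \<and> \<alpha>' = \<xi>^2 \<and> \<beta>' = 0"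
proof -
  \<comment> \<open>Exchanging z and w swaps the columns of the coefficient matrix, so each of the
    four entries can take the place of the nonzero first coefficient.\<close>
  have eq3: "folding_A (\<beta> * z + \<alpha> * w + \<gamma>) (\<beta>' * z + \<alpha>' * w + \<gamma>') n =
      \<beta> * folding_A z w n + \<alpha> * folding_A w z n + \<gamma>" for z w
    using eq1[of w z] by (simp add: ac_simps)
  have eq4: "folding_A (\<beta>' * z + \<alpha>' * w + \<gamma>') (\<beta> * z + \<alpha> * w + \<gamma>) n =
      \<beta>' * folding_A z w n + \<alpha>' * folding_A w z n + \<gamma>'" for z w
    using eq2[of w z] by (simp add: ac_simps)
  \<comment> \<open>Substitution gives x = x^4, and x cancels.\<close>
  have cube: "x^3 = 1" if "x \<noteq> 0" "y = x^2" "x = y^2" for x y :: 'a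
  proof -
    have "x * x^3 = (x^2)^2"
      by (simp add: power2_eq_square power3_eq_cube)
    then have "x * x^3 = x * 1"
      using that(2,3) by (metis mult.right_neutral)
    then show ?thesis using that(1) by simp
  qed
  note d1 = folding_A_diagonal_commute[OF n _ eq1]
  note d2 = folding_A_diagonal_commute[OF n _ eq2]
  note d3 = folding_A_diagonal_commute[OF n _ eq3]
  note d4 = folding_A_diagonal_commute[OF n _ eq4]
  show thesis
  proof (cases "\<alpha> = 0")
    case False
    then have \<beta>: "\<beta> = 0" "\<beta>' \<noteq> 0"
      using d1(1) nz(2) by auto
    then have \<alpha>': "\<alpha>' = 0"
      using d4(1) by simp
    have \<beta>': "\<beta>' = \<alpha>^2"
      by (rule d1(4)[OF False \<alpha>'])
    have "\<alpha> = \<beta>'^2"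
      by (rule d4(4)[OF \<beta>(2) \<beta>(1)])
    with False \<beta>' have "\<alpha>^3 = 1"
      by (rule cube)
    then show thesis
      by (rule that[OF _ d1(2)[OF False] d1(3)[OF False \<alpha>'] d4(3)[OF \<beta>(2) \<beta>(1)]])
        (use \<alpha>' \<beta> \<beta>' in simp)
  next
    case True
    then have \<alpha>': "\<alpha>' \<noteq> 0"
      using nz by simp
    then have \<beta>': "\<beta>' = 0"
      using d2(1) by simp
    then have \<beta>: "\<beta> \<noteq> 0"
      using nz by simp
    have \<alpha>'_eq: "\<alpha>' = \<beta>^2"
      by (rule d3(4)[OF \<beta> \<beta>'])
    have "\<beta> = \<alpha>'^2"
      by (rule d2(4)[OF \<alpha>' True])
    with \<beta> \<alpha>'_eq have "\<beta>^3 = 1"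
      by (rule cube)
    then show thesis
      by (rule that[OF _ d3(2)[OF \<beta>] d3(3)[OF \<beta> \<beta>'] d2(3)[OF \<alpha>' True]])
        (use True \<alpha>'_eq \<beta>' in simp)
  qed
qed

section \<open>Affine maps and the folding map in the coordinates (z, w)\<close>

lemma z_coords_nth [simp]:
  "z_coords i v $ 1 = v $ 1 + i * v $ 2" "z_coords i v $ 2 = v $ 1 - i * v $ 2"
  by (simp_all add: z_coords_def)

text \<open>The second component is the first one for the other square root -i of -1, which
  exchanges z and w.\<close>

lemma z_coords_folding_map:
  assumes "i^2 = -1"
  shows "z_coords i (folding_map n v) =
    vector [folding_A (z_coords i v $ 1) (z_coords i v $ 2) n,
            folding_A (z_coords i v $ 2) (z_coords i v $ 1) n]"
  using folding_A_eq[of i "v $ 1" "v $ 2" n] folding_A_eq[of "- i" "v $ 1" "v $ 2" n] assms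
  by (simp add: vec_eq_iff forall_2 folding_map_def)

lemma
  fixes i :: "'a::field_char_0"
  assumes "i^2 = -1"
  shows z_coords_z_map:
      "z_coords i (z_map i \<xi> v) = vector [\<xi> * z_coords i v $ 1, inverse \<xi> * z_coords i v $ 2]"
    and z_coords_zbar_map:
      "z_coords i (zbar_map i \<xi> v) = vector [\<xi> * z_coords i v $ 2, inverse \<xi> * z_coords i v $ 1]"
  using bij_z_coords[OF assms]
  by (simp_all add: z_map_def zbar_map_def bij_is_surj surj_f_inv_f del: z_coords_nth)

lemma z_coords_eq_iff:
  fixes i :: "'a::field_char_0"
  assumes "i^2 = -1"
  shows "z_coords i u = z_coords i v \<longleftrightarrow> u = v"
  using bij_z_coords[OF assms] by (simp add: bij_is_inj inj_eq)

lemma affine_automorphism_linear: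
  fixes p q r s :: "'a::field"
  assumes "p * s - q * r \<noteq> 0"
  shows "affine_automorphism (\<lambda>v. vector [p * v $ 1 + q * v $ 2, r * v $ 1 + s * v $ 2])"
  unfolding affine_automorphism_def
proof (intro exI conjI)
  let ?M = "vector [vector [p, q], vector [r, s]] :: 'a ^ 2 ^ 2"
  show "invertible ?M"
    using assms by (simp add: invertible_det_nz det_2)
  show "(\<lambda>v. vector [p * v $ 1 + q * v $ 2, r * v $ 1 + s * v $ 2]) = (\<lambda>v. ?M *v v + 0)"
    by (simp add: fun_eq_iff vec_eq_iff forall_2 matrix_vector_mult_def sum_2)
qed

lemma affine_automorphism_z_map:
  fixes i :: "'a::field_char_0"
  assumes i: "i^2 = -1" and \<xi>: "\<xi> \<noteq> 0"
  shows "affine_automorphism (z_map i \<xi>)" and "affine_automorphism (zbar_map i \<xi>)"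
proof -
  have i0: "i \<noteq> 0" and ii: "i * i = -1" "i * (i * x) = - x" for x
    using i by (auto simp: power2_eq_square mult.assoc [symmetric])
  \<comment> \<open>For \<xi> = exp(i t) over the complex numbers these are cos t and - sin t, so
    the matrices below are those of a rotation and a reflection.\<close>
  let ?c = "(\<xi> + inverse \<xi>) / 2" and ?s = "i * (\<xi> - inverse \<xi>) / 2"
  have z: "z_map i \<xi> = (\<lambda>v. vector [?c * v $ 1 + ?s * v $ 2, - ?s * v $ 1 + ?c * v $ 2])"
  proof
    fix v
    have "z_coords i (z_map i \<xi> v) =
        z_coords i (vector [?c * v $ 1 + ?s * v $ 2, - ?s * v $ 1 + ?c * v $ 2])"
      using \<xi> by (simp add: z_coords_z_map[OF i] vec_eq_iff forall_2 field_simps ii)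
    then show "z_map i \<xi> v = vector [?c * v $ 1 + ?s * v $ 2, - ?s * v $ 1 + ?c * v $ 2]"
      by (simp only: z_coords_eq_iff[OF i])
  qed
  have zbar: "zbar_map i \<xi> = (\<lambda>v. vector [?c * v $ 1 + - ?s * v $ 2, - ?s * v $ 1 + - ?c * v $ 2])"
  proof
    fix v
    have "z_coords i (zbar_map i \<xi> v) =
        z_coords i (vector [?c * v $ 1 + - ?s * v $ 2, - ?s * v $ 1 + - ?c * v $ 2])"
      using \<xi> by (simp add: z_coords_zbar_map[OF i] vec_eq_iff forall_2 field_simps ii)
    then show "zbar_map i \<xi> v = vector [?c * v $ 1 + - ?s * v $ 2, - ?s * v $ 1 + - ?c * v $ 2]"
      by (simp only: z_coords_eq_iff[OF i])
  qed
  have det: "?c * ?c + ?s * ?s = 1"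
    using \<xi> by (simp add: field_simps ii)
  show "affine_automorphism (z_map i \<xi>)"
    unfolding z by (rule affine_automorphism_linear) (use det in simp)
  show "affine_automorphism (zbar_map i \<xi>)"
    unfolding zbar
  proof (rule affine_automorphism_linear)
    have "c * - c - - s * - s = - (c * c + s * s)" for c s :: 'a
      by simp
    then show "?c * - ?c - - ?s * - ?s \<noteq> 0"
      by (simp only: det) simp
  qed
qed

lemma carrier_folding_Aut_iff:
  "\<phi> \<in> carrier (folding_Aut n) \<longleftrightarrow>
     affine_automorphism \<phi> \<and> (\<forall>v. folding_map n (\<phi> v) = \<phi> (folding_map n v))"
proof (cases "affine_automorphism \<phi>")
  case True
  then have "bij \<phi>" by (rule affine_automorphism_bij)
  then have "inv' \<phi> u = w \<longleftrightarrow> u = \<phi> w" for u w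
    by (metis bij_inv_eq_iff)
  with True show ?thesis by (simp add: folding_Aut_def fun_eq_iff)
qed (simp add: folding_Aut_def)

lemma affine_automorphism_z_coords:
  fixes i :: "'a::field_char_0"
  assumes i: "i^2 = -1" and \<phi>: "affine_automorphism \<phi>"
  obtains \<alpha> \<beta> \<gamma> \<alpha>' \<beta>' \<gamma>' where
    "\<forall>v. z_coords i (\<phi> v) = vector [\<alpha> * z_coords i v $ 1 + \<beta> * z_coords i v $ 2 + \<gamma>,
       \<alpha>' * z_coords i v $ 1 + \<beta>' * z_coords i v $ 2 + \<gamma>']"
proof -
  have ii: "i * i = -1" "i * (i * x) = - x" for x
    using i by (auto simp: power2_eq_square mult.assoc [symmetric])
  obtain M b where "\<phi> = (\<lambda>v. M *v v + b)"
    using \<phi> by (auto simp: affine_automorphism_def)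
  then have *: "\<phi> v $ k = M $ k $ 1 * v $ 1 + M $ k $ 2 * v $ 2 + b $ k" for v k
    by (simp add: matrix_vector_mult_def sum_2)
  \<comment> \<open>The witnesses solve \<alpha> + \<beta> = p and i (\<alpha> - \<beta>) = q, with
    1/i = -i.\<close>
  have lin: "\<exists>\<alpha> \<beta>. \<forall>x y. p * x + q * y = \<alpha> * (x + i * y) + \<beta> * (x - i * y)" for p q
    by (rule exI[of _ "(p - i * q) / 2"], rule exI[of _ "(p + i * q) / 2"])
       (simp add: field_simps ii)
  obtain \<alpha> \<beta> where 1: "(M $ 1 $ 1 + i * M $ 2 $ 1) * x + (M $ 1 $ 2 + i * M $ 2 $ 2) * y =
      \<alpha> * (x + i * y) + \<beta> * (x - i * y)" for x y
    using lin by meson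
  obtain \<alpha>' \<beta>' where 2: "(M $ 1 $ 1 - i * M $ 2 $ 1) * x + (M $ 1 $ 2 - i * M $ 2 $ 2) * y =
      \<alpha>' * (x + i * y) + \<beta>' * (x - i * y)" for x y
    using lin by meson
  show thesis
  proof (rule that[of \<alpha> \<beta> "b $ 1 + i * b $ 2" \<alpha>' \<beta>' "b $ 1 - i * b $ 2"], rule allI)
    fix v
    show "z_coords i (\<phi> v) = vector [\<alpha> * z_coords i v $ 1 + \<beta> * z_coords i v $ 2 + (b $ 1 + i * b $ 2),
       \<alpha>' * z_coords i v $ 1 + \<beta>' * z_coords i v $ 2 + (b $ 1 - i * b $ 2)]"
      using 1[of "v $ 1" "v $ 2"] 2[of "v $ 1" "v $ 2"]
      by (simp add: vec_eq_iff forall_2 *) (simp add: algebra_simps)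
  qed
qed

section \<open>Determination of the automorphisms\<close>

lemma inverse_cube_root_of_unity:
  fixes \<xi> :: "'a::field"
  assumes "\<xi>^3 = 1"
  shows "\<xi> \<noteq> 0" and "inverse \<xi> = \<xi>^2" and "(\<xi>^2)^3 = 1" and "(\<xi>^2)^2 = \<xi>"
proof -
  show \<xi>: "\<xi> \<noteq> 0"
    using assms by auto
  have "\<xi> * \<xi>^2 = 1"
    using assms by (simp add: power3_eq_cube power2_eq_square mult.assoc)
  then show "inverse \<xi> = \<xi>^2"
    by (rule inverse_unique)
  show "(\<xi>^2)^3 = 1"
    using assms by (metis power_commutes power_mult mult.commute power_one)
  have "(\<xi>^2)^2 = \<xi>^3 * \<xi>"
    by (simp add: power3_eq_cube power2_eq_square)
  then show "(\<xi>^2)^2 = \<xi>"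
    using assms by simp
qed

text \<open>The condition \<open>\<xi>^n = \<xi>\<close> treats all residues of n at once: on cube
  roots of unity it is void for n = 1 modulo 3 and leaves only \<xi> = 1 otherwise.\<close>

lemma carrier_folding_Aut:
  fixes i :: "'a::field_char_0"
  assumes n: "n \<ge> 2" and i: "i^2 = -1"
  shows "carrier (folding_Aut n) =
    z_map i ` {\<xi>. \<xi>^3 = 1 \<and> \<xi>^n = \<xi>} \<union> zbar_map i ` {\<xi>. \<xi>^3 = 1 \<and> \<xi>^n = \<xi>}"
    (is "_ = ?R")
proof (intro equalityI subsetI)
  fix \<phi> :: "'a ^ 2 \<Rightarrow> 'a ^ 2"
  let ?L = "z_coords i"
  assume "\<phi> \<in> carrier (folding_Aut n)"
  then have aff: "affine_automorphism \<phi>" and comm: "folding_map n (\<phi> v) = \<phi> (folding_map n v)" for v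
    by (auto simp: carrier_folding_Aut_iff)
  obtain \<alpha> \<beta> \<gamma> \<alpha>' \<beta>' \<gamma>' where "\<forall>v. ?L (\<phi> v) = vector [\<alpha> * ?L v $ 1 + \<beta> * ?L v $ 2 + \<gamma>,
       \<alpha>' * ?L v $ 1 + \<beta>' * ?L v $ 2 + \<gamma>']"
    by (rule affine_automorphism_z_coords[OF i aff])
  then have L: "?L (\<phi> v) = vector [\<alpha> * ?L v $ 1 + \<beta> * ?L v $ 2 + \<gamma>,
       \<alpha>' * ?L v $ 1 + \<beta>' * ?L v $ 2 + \<gamma>']" for v
    by blast
  \<comment> \<open>Since \<open>z_coords i\<close> is onto, commutation at all points v becomes an
    identity in arbitrary z and w.\<close>
  have point: "\<exists>v. ?L v = vector [z, w]" for z w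
    using surjD[OF bij_is_surj[OF bij_z_coords[OF i]]] by metis
  have eqs: "folding_A (\<alpha> * z + \<beta> * w + \<gamma>) (\<alpha>' * z + \<beta>' * w + \<gamma>') n =
      \<alpha> * folding_A z w n + \<beta> * folding_A w z n + \<gamma> \<and>
    folding_A (\<alpha>' * z + \<beta>' * w + \<gamma>') (\<alpha> * z + \<beta> * w + \<gamma>) n =
      \<alpha>' * folding_A z w n + \<beta>' * folding_A w z n + \<gamma>'" for z w
  proof -
    obtain v where v: "?L v = vector [z, w]" using point by blast
    have "?L (folding_map n (\<phi> v)) = ?L (\<phi> (folding_map n v))"
      by (simp add: comm)
    then show ?thesis
      by (simp only: L z_coords_folding_map[OF i] v vector_2 vec_eq_iff forall_2)
  qed
  have inj: "\<phi> u = \<phi> v \<longleftrightarrow> u = v" for u v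
    using affine_automorphism_bij(1)[OF aff] by (simp add: bij_is_inj inj_eq)
  \<comment> \<open>By injectivity of \<phi>, the images of (1, 0) and (0, 1) differ from the image
    of the origin; the differences are the columns of the coefficient matrix, which are therefore
    nonzero.\<close>
  obtain o' e1 e2 where pts: "?L o' = vector [0, 0]" "?L e1 = vector [1, 0]" "?L e2 = vector [0, 1]"
    using point by meson
  have "o' \<noteq> e1" "o' \<noteq> e2"
    using arg_cong[of o' e1 "\<lambda>v. ?L v $ 1"] arg_cong[of o' e2 "\<lambda>v. ?L v $ 2"]
    unfolding pts by auto
  then have "?L (\<phi> o') \<noteq> ?L (\<phi> e1)" "?L (\<phi> o') \<noteq> ?L (\<phi> e2)"
    by (simp_all only: z_coords_eq_iff[OF i] inj not_False_eq_True)
  then have nz: "\<alpha> \<noteq> 0 \<or> \<alpha>' \<noteq> 0" "\<beta> \<noteq> 0 \<or> \<beta>' \<noteq> 0"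
    by (auto simp: L pts vec_eq_iff forall_2 simp del: z_coords_nth)
  obtain \<xi> where \<xi>: "\<xi>^3 = 1" "\<xi>^n = \<xi>" and \<gamma>: "\<gamma> = 0" "\<gamma>' = 0"
    and alt: "\<alpha> = \<xi> \<and> \<beta> = 0 \<and> \<alpha>' = 0 \<and> \<beta>' = \<xi>^2 \<or> \<alpha> = 0 \<and> \<beta> = \<xi> \<and> \<alpha>' = \<xi>^2 \<and> \<beta>' = 0"
    by (rule folding_A_affine_commute[OF n conjunct1[OF eqs] conjunct2[OF eqs] nz])
  from alt have "\<phi> = z_map i \<xi> \<or> \<phi> = zbar_map i \<xi>"
  proof
    assume *: "\<alpha> = \<xi> \<and> \<beta> = 0 \<and> \<alpha>' = 0 \<and> \<beta>' = \<xi>^2"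
    have "?L (\<phi> v) = ?L (z_map i \<xi> v)" for v
      by (simp add: L z_coords_z_map[OF i] * \<gamma> inverse_cube_root_of_unity[OF \<xi>(1)] del: z_coords_nth)
    then show ?thesis by (auto simp: z_coords_eq_iff[OF i])
  next
    assume *: "\<alpha> = 0 \<and> \<beta> = \<xi> \<and> \<alpha>' = \<xi>^2 \<and> \<beta>' = 0"
    have "?L (\<phi> v) = ?L (zbar_map i \<xi> v)" for v
      by (simp add: L z_coords_zbar_map[OF i] * \<gamma> inverse_cube_root_of_unity[OF \<xi>(1)] del: z_coords_nth)
    then show ?thesis by (auto simp: z_coords_eq_iff[OF i])
  qed
  with \<xi> show "\<phi> \<in> ?R" by blast
next
  fix \<phi> :: "'a ^ 2 \<Rightarrow> 'a ^ 2"
  assume "\<phi> \<in> ?R"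
  then obtain \<xi> where \<xi>: "\<xi>^3 = 1" "\<xi>^n = \<xi>" and \<phi>: "\<phi> = z_map i \<xi> \<or> \<phi> = zbar_map i \<xi>"
    by blast
  note inv = inverse_cube_root_of_unity[OF \<xi>(1)]
  have A: "folding_A (\<xi> * z) (\<xi>^2 * w) n = \<xi> * folding_A z w n" for z w
    using folding_A_scale[OF \<xi>(1), of z w n] \<xi>(2) by simp
  \<comment> \<open>The second component needs the scaling law for \<open>\<xi>^2\<close> in place
    of \<open>\<xi>\<close>, whose square is \<open>\<xi>\<close> again.\<close>
  have "(\<xi>^2)^n = \<xi>^2"
    using \<xi>(2) by (metis power_mult mult.commute)
  then have A2: "folding_A (\<xi>^2 * z) (\<xi> * w) n = \<xi>^2 * folding_A z w n" for z w
    using folding_A_scale[OF inv(3), of z w n] inv(4) by simp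
  have "z_coords i (folding_map n (\<phi> v)) = z_coords i (\<phi> (folding_map n v))" for v
    using \<phi> by (auto simp: z_coords_folding_map[OF i] z_coords_z_map[OF i] z_coords_zbar_map[OF i]
        inv A A2 simp del: z_coords_nth)
  moreover have "affine_automorphism \<phi>"
    using \<phi> affine_automorphism_z_map[OF i inv(1)] by auto
  ultimately show "\<phi> \<in> carrier (folding_Aut n)"
    by (simp add: carrier_folding_Aut_iff z_coords_eq_iff[OF i])
qed

section \<open>Recognition of the symmetric group and of the group of order 2\<close>

lemma is_iso_sym_groupI:
  fixes G :: "('a \<Rightarrow> 'a) monoid"
  assumes mult: "mult G = (\<circ>)" and S: "bij_betw P {1..m} S"
    and inj: "\<And>\<phi>. \<phi> \<in> carrier G \<Longrightarrow> inj \<phi>"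
    and act: "\<And>\<phi> v. \<phi> \<in> carrier G \<Longrightarrow> v \<in> S \<Longrightarrow> \<phi> v \<in> S"
    and faithful: "\<And>\<phi> \<psi>. \<phi> \<in> carrier G \<Longrightarrow> \<psi> \<in> carrier G \<Longrightarrow> (\<And>v. v \<in> S \<Longrightarrow> \<phi> v = \<psi> v) \<Longrightarrow> \<phi> = \<psi>"
    and card: "card (carrier G) = fact m"
  shows "G \<cong> sym_group m"
proof -
  let ?Q = "inv_into {1..m} P"
  \<comment> \<open>The action on S is transported to {1..m} along the labelling P. Outside {1..m}
    the value is the identity, as \<open>permutes\<close> demands.\<close>
  define h where "h \<phi> k = (if k \<in> {1..m} then ?Q (\<phi> (P k)) else k)" for \<phi> k
  have PS: "P k \<in> S" if "k \<in> {1..m}" for k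
    using S that by (auto simp: bij_betw_def)
  have PQ: "P (?Q v) = v" "?Q v \<in> {1..m}" if "v \<in> S" for v
    using S that by (auto simp: bij_betw_def f_inv_into_f inv_into_into)
  have QP: "?Q (P k) = k" if "k \<in> {1..m}" for k
    using S that by (auto simp: bij_betw_def)
  have S_fin: "finite S"
    using S bij_betw_finite by blast
  have perm: "h \<phi> permutes {1..m}" if \<phi>: "\<phi> \<in> carrier G" for \<phi>
  proof (rule bij_imp_permutes)
    have "\<phi> ` S = S"
      using act[OF \<phi>] inj[OF \<phi>] S_fin by (intro endo_inj_surj) (auto simp: inj_on_def)
    then have "bij_betw \<phi> S S"
      using inj[OF \<phi>] by (auto simp: bij_betw_def inj_on_def)
    then have "bij_betw (?Q \<circ> (\<phi> \<circ> P)) {1..m} {1..m}"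
      using S bij_betw_inv_into[OF S] by (blast intro: bij_betw_trans)
    then show "bij_betw (h \<phi>) {1..m} {1..m}"
      by (rule bij_betw_cong[THEN iffD1, rotated]) (simp add: h_def)
  qed (unfold h_def, simp only: if_False)
  have "h (\<phi> \<circ> \<psi>) = h \<phi> \<circ> h \<psi>" if "\<phi> \<in> carrier G" "\<psi> \<in> carrier G" for \<phi> \<psi>
    using PQ act[OF that(2) PS] by (auto simp: fun_eq_iff h_def)
  then have hom: "h \<in> hom G (sym_group m)"
    by (simp add: hom_def mult sym_group_def Pi_iff perm del: One_nat_def)
  have inj_h: "inj_on h (carrier G)"
  proof (rule inj_onI)
    fix \<phi> \<psi> assume \<phi>: "\<phi> \<in> carrier G" and \<psi>: "\<psi> \<in> carrier G" and eq: "h \<phi> = h \<psi>"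
    show "\<phi> = \<psi>"
    proof (rule faithful[OF \<phi> \<psi>])
      fix v assume v: "v \<in> S"
      have "?Q (\<phi> v) = ?Q (\<psi> v)"
        using fun_cong[OF eq, of "?Q v"] PQ[OF v] by (simp add: h_def)
      then show "\<phi> v = \<psi> v"
        using PQ(1)[OF act[OF \<phi> v]] PQ(1)[OF act[OF \<psi> v]] by simp
    qed
  qed
  have "card {p. p permutes {1..m}} = fact m"
    by (rule card_permutations) auto
  \<comment> \<open>Faithfulness makes h injective, and both groups have m! elements, so h is
    onto.\<close>
  then have "h ` carrier G = carrier (sym_group m)"
    using perm card card_image[OF inj_h]
    by (intro card_subset_eq) (auto simp: sym_group_def finite_permutations)
  with hom inj_h show ?thesis
    by (intro is_isoI) (simp add: iso_iff)
qed

lemma is_iso_integer_mod_group_2I: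
  assumes "group G" "carrier G = {\<one>\<^bsub>G\<^esub>, s}" "s \<noteq> \<one>\<^bsub>G\<^esub>" "s \<otimes>\<^bsub>G\<^esub> s = \<one>\<^bsub>G\<^esub>"
  shows "G \<cong> integer_mod_group 2"
proof -
  interpret group G by fact
  have two: "{0..<2} = {0, 1::int}" by auto
  have "(\<lambda>x. if x = \<one>\<^bsub>G\<^esub> then 0 else 1) \<in> iso G (integer_mod_group 2)"
    using assms(2-) r_one[of s] l_one[of s]
    by (auto simp: iso_def hom_def bij_betw_def inj_on_def carrier_integer_mod_group two)
  then show ?thesis by (rule is_isoI)
qed

section \<open>Cube roots of unity\<close>

lemma cube_roots_of_unity:
  fixes \<zeta> :: "'a::field"
  assumes "primitive_root_of_unity 3 \<zeta>"
  shows "{\<xi>. \<xi>^3 = 1} = {1, \<zeta>, \<zeta>^2}" and "distinct [1, \<zeta>, \<zeta>^2]"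
proof -
  have \<zeta>3: "\<zeta>^3 = 1" and \<zeta>: "\<zeta> \<noteq> 1"
    using assms by (auto simp: primitive_root_of_unity_def dest!: spec[of _ "Suc 0"])
  have \<zeta>2: "\<zeta>^2 \<noteq> 1"
    using assms by (simp add: primitive_root_of_unity_def)
  then show "distinct [1, \<zeta>, \<zeta>^2]"
    using \<zeta> \<zeta>3 by (auto simp: power2_eq_square)
  have "(\<zeta> - 1) * (1 + \<zeta> + \<zeta>^2) = \<zeta>^3 - 1"
    by (simp add: algebra_simps power2_eq_square power3_eq_cube)
  then have sum: "1 + \<zeta> + \<zeta>^2 = 0"
    using \<zeta>3 \<zeta> by simp
  \<comment> \<open>The first two elementary symmetric functions of 1, \<zeta>, \<zeta>^2 vanish and
    the third is 1.\<close>
  have "\<xi>^3 - 1 = (\<xi> - 1) * (\<xi> - \<zeta>) * (\<xi> - \<zeta>^2)" for \<xi>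
  proof -
    have "(\<xi> - 1) * (\<xi> - \<zeta>) * (\<xi> - \<zeta>^2) =
        \<xi>^3 - (1 + \<zeta> + \<zeta>^2) * \<xi>^2 + (\<zeta> + \<zeta>^2 + \<zeta>^3) * \<xi> - \<zeta>^3"
      by (simp add: algebra_simps power2_eq_square power3_eq_cube)
    moreover have "\<zeta> + \<zeta>^2 + \<zeta>^3 = 0"
      using sum \<zeta>3 by (simp add: ac_simps)
    ultimately show ?thesis
      by (simp add: sum \<zeta>3)
  qed
  then have "\<xi>^3 = 1 \<longleftrightarrow> \<xi> = 1 \<or> \<xi> = \<zeta> \<or> \<xi> = \<zeta>^2" for \<xi>
    by (metis eq_iff_diff_eq_0 mult_eq_0_iff)
  then show "{\<xi>. \<xi>^3 = 1} = {1, \<zeta>, \<zeta>^2}"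
    by auto
qed

lemma ex_primitive_cube_root_of_unity:
  "\<exists>\<zeta>::'a::{alg_closed_field, field_char_0}. primitive_root_of_unity 3 \<zeta>"
proof -
  obtain s :: 'a where s: "s^2 = -3"
    using nth_root_exists[of 2 "-3 :: 'a"] by auto
  \<comment> \<open>A root of X^2 + X + 1, whose discriminant is -3, by the quadratic
    formula.\<close>
  define \<zeta> where "\<zeta> = (s - 1) / 2"
  have sum: "\<zeta>^2 + \<zeta> + 1 = 0"
    using s by (simp add: \<zeta>_def power2_eq_square field_simps)
  have "\<zeta>^3 - 1 = (\<zeta> - 1) * (\<zeta>^2 + \<zeta> + 1)"
    by (simp add: algebra_simps power2_eq_square power3_eq_cube)
  then have "\<zeta>^3 = 1"
    using sum by simp
  moreover have "\<zeta> \<noteq> 1"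
    using sum by auto
  moreover have "\<zeta>^2 \<noteq> 1"
  proof
    assume "\<zeta>^2 = 1"
    then have "\<zeta> * 1 = 1"
      using \<open>\<zeta>^3 = 1\<close> by (metis power2_eq_square power3_eq_cube mult.assoc)
    then show False
      using \<open>\<zeta> \<noteq> 1\<close> by simp
  qed
  moreover have "j = 1 \<or> j = 2" if "0 < j \<and> j < 3" for j :: nat
    using that by auto
  ultimately have "primitive_root_of_unity 3 \<zeta>"
    unfolding primitive_root_of_unity_def by (metis power_one_right zero_less_numeral)
  then show ?thesis ..
qed

text \<open>Only n modulo 3 matters. Residue 0 gives 1 = \<xi>, and residue 2 gives \<xi>^2 = \<xi>,
  which again means \<xi> = 1 because \<xi> is nonzero.\<close>

lemma cube_root_of_unity_power_eq_self_iff: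
  fixes \<xi> :: "'a::field"
  assumes "\<xi>^3 = 1"
  shows "\<xi>^n = \<xi> \<longleftrightarrow> [n = 1] (mod 3) \<or> \<xi> = 1"
proof -
  have "\<xi>^n = \<xi>^(3 * (n div 3) + n mod 3)"
    by simp
  also have "\<dots> = \<xi>^(n mod 3)"
    by (simp only: power_add power_mult assms power_one mult_1)
  finally have n: "\<xi>^n = \<xi>^(n mod 3)" .
  have \<xi>: "\<xi> \<noteq> 0"
    using assms by auto
  consider "n mod 3 = 0" | "n mod 3 = 1" | "n mod 3 = 2"
    by linarith
  then show ?thesis
    using \<xi> by cases (auto simp: n cong_def power2_eq_square)
qed

section \<open>The case n = 1 modulo 3: a faithful action on three points\<close>

lemma z_maps_eq_iff:
  fixes i :: "'a::field_char_0"
  assumes i: "i^2 = -1" and \<zeta>: "\<zeta>^2 \<noteq> \<zeta>" and \<xi>: "\<xi> \<noteq> 0"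
    and p: "z_coords i p = vector [1, 1]" and q: "z_coords i q = vector [\<zeta>, \<zeta>^2]"
  shows "z_map i \<xi> p = z_map i \<eta> p \<longleftrightarrow> \<xi> = \<eta>" and "zbar_map i \<xi> p = zbar_map i \<eta> p \<longleftrightarrow> \<xi> = \<eta>"
    and "z_map i \<xi> p \<noteq> zbar_map i \<eta> p \<or> z_map i \<xi> q \<noteq> zbar_map i \<eta> q"
  \<comment> \<open>The point p separates maps of the same kind. Maps of different kinds agree at p
    only if \<xi> = \<eta>, and agreement at q would then give \<zeta> = \<zeta>^2.\<close>
  using \<xi> \<zeta> unfolding z_coords_eq_iff[OF i, of "z_map i \<xi> _", symmetric]
    z_coords_eq_iff[OF i, of "zbar_map i \<xi> _", symmetric] z_coords_z_map[OF i] z_coords_zbar_map[OF i] p q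
  by (auto simp: vec_eq_iff forall_2)

lemma folding_Aut_iso_sym_group:
  assumes n: "n \<ge> 2" and n1: "[n = 1] (mod 3)"
  shows "(folding_Aut n :: ('a::{alg_closed_field, field_char_0} ^ 2 \<Rightarrow> 'a ^ 2) monoid) \<cong> sym_group 3"
proof -
  obtain i :: 'a where i: "i^2 = -1"
    using nth_root_exists[of 2 "-1 :: 'a"] by auto
  obtain \<zeta> :: 'a where \<zeta>: "primitive_root_of_unity 3 \<zeta>"
    using ex_primitive_cube_root_of_unity by blast
  note roots = cube_roots_of_unity[OF \<zeta>]
  let ?U = "{\<xi>::'a. \<xi>^3 = 1}"
  have carr: "carrier (folding_Aut n) = z_map i ` ?U \<union> zbar_map i ` ?U"
    using carrier_folding_Aut[OF n i] n1 by (simp add: cube_root_of_unity_power_eq_self_iff cong: conj_cong)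
  have card_U: "card ?U = 3" and fin_U: "finite ?U"
    unfolding roots(1) using roots(2) by auto
  \<comment> \<open>For a cube root of unity z the second coordinate z^2 is the inverse of z; over
    the complex numbers these points are the cube roots of unity in the real plane, which the
    rotations and reflections permute.\<close>
  define p where "p z = inv' (z_coords i) (vector [z, z^2])" for z
  have p: "z_coords i (p z) = vector [z, z^2]" for z
    using bij_z_coords[OF i] by (simp add: p_def bij_is_surj surj_f_inv_f del: z_coords_nth)
  have inj_p: "inj p"
  proof (rule injI)
    fix z w assume "p z = p w"
    then have "z_coords i (p z) $ 1 = z_coords i (p w) $ 1"
      by simp
    then show "z = w"
      by (simp only: p vector_2)
  qed
  obtain e where e: "bij_betw e {1..3::nat} ?U"
    using finite_same_card_bij[of "{1..3::nat}" ?U] card_U fin_U by auto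
  have bij: "bij_betw (p \<circ> e) {1..3} (p ` ?U)"
    using e inj_p by (intro bij_betw_trans[OF e]) (auto simp: bij_betw_def inj_on_def)
  have act: "z_map i \<xi> (p z) = p (\<xi> * z)" "zbar_map i \<xi> (p z) = p (\<xi> * z^2)"
    if "\<xi>^3 = 1" "z^3 = 1" for \<xi> z
    unfolding z_coords_eq_iff[OF i, of _ "p _", symmetric] z_coords_z_map[OF i] z_coords_zbar_map[OF i] p
    by (simp_all add: power_mult_distrib inverse_cube_root_of_unity[OF that(1)]
        inverse_cube_root_of_unity(4)[OF that(2), simplified])
  have distinct: "\<zeta>^2 \<noteq> \<zeta>" and \<zeta>3: "\<zeta>^3 = 1"
    using roots by auto
  note eq_iff = z_maps_eq_iff[OF i distinct _ p[of 1, simplified] p[of \<zeta>]]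
  have nz: "\<xi> \<noteq> 0" if "\<xi>^3 = 1" for \<xi> :: 'a
    using that by (rule inverse_cube_root_of_unity)
  have "inj_on (z_map i) ?U" "inj_on (zbar_map i) ?U"
    unfolding inj_on_def
    by (metis (mono_tags) eq_iff(1) nz mem_Collect_eq, metis (mono_tags) eq_iff(2) nz mem_Collect_eq)
  moreover have "z_map i \<xi> \<noteq> zbar_map i \<eta>" if "\<xi>^3 = 1" for \<xi> \<eta>
    using eq_iff(3)[OF nz[OF that], of \<eta>] by auto
  then have "z_map i ` ?U \<inter> zbar_map i ` ?U = {}"
    by blast
  ultimately have card: "card (carrier (folding_Aut n :: ('a ^ 2 \<Rightarrow> 'a ^ 2) monoid)) = fact 3"
    unfolding carr using fin_U by (simp add: card_Un_disjoint card_image card_U fact_numeral)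
  show ?thesis
  proof (rule is_iso_sym_groupI[OF _ bij _ _ _ card])
    fix \<phi> :: "'a ^ 2 \<Rightarrow> 'a ^ 2"
    assume \<phi>: "\<phi> \<in> carrier (folding_Aut n)"
    show "inj \<phi>"
      using \<phi> affine_automorphism_bij(1) bij_is_inj unfolding carrier_folding_Aut_iff by blast
    show "\<phi> v \<in> p ` ?U" if "v \<in> p ` ?U" for v
    proof -
      have "(\<xi> * z)^3 = 1" "(\<xi> * z^2)^3 = 1" if "\<xi>^3 = 1" "z^3 = 1" for \<xi> z :: 'a
        using that inverse_cube_root_of_unity(3)[of z] by (simp_all only: power_mult_distrib mult_1)
      then show ?thesis
        using \<phi> that by (auto simp: carr act)
    qed
    fix \<psi> :: "'a ^ 2 \<Rightarrow> 'a ^ 2"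
    assume \<psi>: "\<psi> \<in> carrier (folding_Aut n)" and "\<And>v. v \<in> p ` ?U \<Longrightarrow> \<phi> v = \<psi> v"
    \<comment> \<open>Agreement at these two of the three points already forces equality.\<close>
    then have eq: "\<phi> (p 1) = \<psi> (p 1)" "\<phi> (p \<zeta>) = \<psi> (p \<zeta>)"
      using \<zeta>3 by auto
    obtain \<xi> where \<xi>: "\<xi> \<noteq> 0" and \<phi>\<xi>: "\<phi> = z_map i \<xi> \<or> \<phi> = zbar_map i \<xi>"
      using \<phi> nz unfolding carr by blast
    obtain \<eta> where \<eta>: "\<eta> \<noteq> 0" and \<psi>\<eta>: "\<psi> = z_map i \<eta> \<or> \<psi> = zbar_map i \<eta>"
      using \<psi> nz unfolding carr by blast
    from \<phi>\<xi> \<psi>\<eta> show "\<phi> = \<psi>"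
      using eq eq_iff(1,2)[OF \<xi>, of \<eta>] eq_iff(3)[OF \<xi>, of \<eta>] eq_iff(3)[OF \<eta>, of \<xi>] by metis
  qed (simp add: folding_Aut_def)
qed

section \<open>The remaining residues and the theorem\<close>

lemma z_map_1:
  fixes i :: "'a::field_char_0"
  assumes i: "i^2 = -1"
  shows "z_map i 1 = id" and "zbar_map i 1 \<circ> zbar_map i 1 = id" and "zbar_map i 1 \<noteq> id"
proof -
  have "z_coords i (z_map i 1 v) = z_coords i v"
    "z_coords i (zbar_map i 1 (zbar_map i 1 v)) = z_coords i v" for v
    by (simp_all add: z_coords_z_map[OF i] z_coords_zbar_map[OF i] vec_eq_iff forall_2 del: z_coords_nth)
  then show "z_map i 1 = id" "zbar_map i 1 \<circ> zbar_map i 1 = id"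
    by (simp_all add: fun_eq_iff z_coords_eq_iff[OF i])
  obtain v where v: "z_coords i v = vector [1, 0]"
    using surjD[OF bij_is_surj[OF bij_z_coords[OF i]]] by metis
  have "z_coords i (zbar_map i 1 v) $ 1 \<noteq> z_coords i v $ 1"
    by (simp add: z_coords_zbar_map[OF i] v del: z_coords_nth)
  then show "zbar_map i 1 \<noteq> id"
    by (metis id_apply)
qed

theorem theorem2p6:
  fixes n :: nat
  assumes "n \<ge> 2"
  shows "(let Aut = (folding_Aut n :: ('K::{alg_closed_field, field_char_0} ^ 2 \<Rightarrow> 'K ^ 2) monoid) in
      (if [n = 1] (mod 3) then Aut \<cong> sym_group 3 else Aut \<cong> integer_mod_group 2) \<and>
      (\<forall>(i::'K) (\<zeta>::'K). i^2 = -1 \<longrightarrow> primitive_root_of_unity 3 \<zeta> \<longrightarrow>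
         carrier Aut =
           (if [n = 1] (mod 3)
            then {z_map i 1, z_map i \<zeta>, z_map i (\<zeta>^2),
                  zbar_map i 1, zbar_map i \<zeta>, zbar_map i (\<zeta>^2)}
            else {z_map i 1, zbar_map i 1})))"
proof -
  let ?Aut = "folding_Aut n :: ('K ^ 2 \<Rightarrow> 'K ^ 2) monoid"
  \<comment> \<open>The split by the residue of n enters only here, through the set of admissible
    multipliers.\<close>
  have U: "{\<xi>::'K. \<xi>^3 = 1 \<and> \<xi>^n = \<xi>} = (if [n = 1] (mod 3) then {\<xi>. \<xi>^3 = 1} else {1})"
    by (auto simp: cube_root_of_unity_power_eq_self_iff)
  note carr = carrier_folding_Aut[OF assms, where 'a = 'K, unfolded U]
  have "?Aut \<cong> integer_mod_group 2" if "\<not> [n = 1] (mod 3)"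
  proof -
    \<comment> \<open>The isomorphism type mentions no i, so some square root of -1 is chosen to
      list the two elements, the identity and the involution \<open>zbar_map i 1\<close>.\<close>
    obtain i :: 'K where i: "i^2 = -1"
      using nth_root_exists[of 2 "-1 :: 'K"] by auto
    show ?thesis
      by (rule is_iso_integer_mod_group_2I[OF group_folding_Aut, of _ "zbar_map i 1"])
        (use carr[OF i] that z_map_1[OF i] in \<open>auto simp: folding_Aut_def\<close>)
  qed
  moreover have "carrier ?Aut =
      (if [n = 1] (mod 3)
       then {z_map i 1, z_map i \<zeta>, z_map i (\<zeta>^2), zbar_map i 1, zbar_map i \<zeta>, zbar_map i (\<zeta>^2)}
       else {z_map i 1, zbar_map i 1})" if "i^2 = -1" "primitive_root_of_unity 3 \<zeta>" for i \<zeta> :: 'K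
    using carr[OF that(1)] cube_roots_of_unity(1)[OF that(2)] by auto
  ultimately show ?thesis
    using folding_Aut_iso_sym_group[OF assms, where 'a = 'K] by (simp add: Let_def)
qed

end
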